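(* Let $\mathbb{B}=\{\mathbf{v}\in\mathbb{R}^n : \|\mathbf{v}\|<1\}$ be the open unit ball in $n$-dimensional Euclidean space, where $\|\cdot\|$ is the Euclidean norm, and let $\oplus_M$ be Möbius addition on $\mathbb{B}$. Let $\Phi\colon\mathbb{B}\to\mathbb{B}$ be given by $\Phi(\mathbf{v})=\dfrac{2}{1+\|\mathbf{v}\|^2}\mathbf{v}$, and let $\|\mathbf{v}\|_E=\tanh^{-1}\|\mathbf{v}\|$ for $\mathbf{v}\in\mathbb{B}$. Then the function $\|\cdot\|_M\colon\mathbb{B}\to\mathbb{R}$ defined by $$\|\mathbf{v}\|_M=\frac{1}{2}\|\Phi(\mathbf{v})\|_E,\qquad\mathbf{v}\in\mathbb{B},$$ is a gyronorm on the Möbius gyrogroup $(\mathbb{B},\oplus_M)$.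
   Context: A gyrogroup is a nonempty set $G$ with a binary operation $\oplus$ such that: (G1) there is an element $e\in G$ with $e\oplus a=a$ for all $a\in G$; (G2) for each $a\in G$ there is $b\in G$ with $b\oplus a=e$; (G3) for all $a,b\in G$ there is an automorphism $\mathrm{gyr}[a,b]$ of $(G,\oplus)$ (a bijection $G\to G$ preserving $\oplus$) such that $a\oplus(b\oplus c)=(a\oplus b)\oplus\mathrm{gyr}[a,b]c$ for all $c\in G$; (G4) $\mathrm{gyr}[a\oplus b,b]=\mathrm{gyr}[a,b]$ for all $a,b\in G$. Then $e$ is the unique two-sided identity and each $a$ has a unique two-sided inverse $\ominus a$; $\mathrm{gyr}[a,b]$ is called the gyroautomorphism generated by $a$ and $b$. A gyronorm on a gyrogroup $G$ is a function $\|\cdot\|\colon G\to\mathbb{R}$ such that: (1) $\|x\|\ge 0$ for all $x\in G$, and $\|x\|=0$ if and only if $x=e$; (2) $\|\ominus x\|=\|x\|$ for all $x\in G$; (3) $\|x\oplus y\|\le\|x\|+\|y\|$ for all $x,y\in G$; (4) $\|\mathrm{gyr}[a,b]x\|=\|x\|$ for all $a,b,x\in G$. Möbius addition on $\mathbb{B}$ is defined by $$\mathbf{u}\oplus_M\mathbf{v}=\frac{(1+2\langle\mathbf{u},\mathbf{v}\rangle+\|\mathbf{v}\|^2)\mathbf{u}+(1-\|\mathbf{u}\|^2)\mathbf{v}}{1+2\langle\mathbf{u},\mathbf{v}\rangle+\|\mathbf{u}\|^2\|\mathbf{v}\|^2},$$ where $\langle\cdot,\cdot\rangle$ is the Euclidean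 inner product. It is known that $(\mathbb{B},\oplus_M)$ is a gyrogroup, called the Möbius gyrogroup; its identity is $\mathbf{0}$, and the inverse of $\mathbf{v}$ is $-\mathbf{v}$. Here $\tanh^{-1}$ is the inverse of the hyperbolic tangent function on $\mathbb{R}$. *)

theory Defs
  imports "HOL-Analysis.Analysis"
begin

definition automorphism_on :: "'a set \<Rightarrow> ('a \<Rightarrow> 'a \<Rightarrow> 'a) \<Rightarrow> ('a \<Rightarrow> 'a) \<Rightarrow> bool" where
  "automorphism_on G add f \<longleftrightarrow>
     bij_betw f G G \<and> (\<forall>x\<in>G. \<forall>y\<in>G. f (add x y) = add (f x) (f y))"

text \<open>The left loop property equates the maps \<open>gyr[a \<oplus> b, b]\<close> and \<open>gyr[a, b]\<close> of \<open>G\<close>, so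
  it is stated pointwise on \<open>G\<close>.\<close>

definition gyr_family :: "'a set \<Rightarrow> ('a \<Rightarrow> 'a \<Rightarrow> 'a) \<Rightarrow> ('a \<Rightarrow> 'a \<Rightarrow> 'a \<Rightarrow> 'a) \<Rightarrow> bool" where
  "gyr_family G add g \<longleftrightarrow>
     (\<forall>a\<in>G. \<forall>b\<in>G. automorphism_on G add (g a b) \<and>
        (\<forall>c\<in>G. add a (add b c) = add (add a b) (g a b c))) \<and>
     (\<forall>a\<in>G. \<forall>b\<in>G. \<forall>c\<in>G. g (add a b) b c = g a b c)"

locale gyrogroup =
  fixes G :: "'a set" and add :: "'a \<Rightarrow> 'a \<Rightarrow> 'a"  (infixl "\<oplus>" 65)
  assumes add_closed: "\<And>a b. a \<in> G \<Longrightarrow> b \<in> G \<Longrightarrow> a \<oplus> b \<in> G"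
    and left_id_inv: "\<exists>e\<in>G. (\<forall>a\<in>G. e \<oplus> a = a) \<and> (\<forall>a\<in>G. \<exists>b\<in>G. b \<oplus> a = e)"
    and ex_gyr: "\<exists>g. gyr_family G (\<oplus>) g"
begin

definition gyro_id :: 'a where
  "gyro_id = (THE e. e \<in> G \<and> (\<forall>a\<in>G. e \<oplus> a = a))"

definition gyro_inv :: "'a \<Rightarrow> 'a"  ("\<ominus> _" [81] 80) where
  "\<ominus> a = (THE b. b \<in> G \<and> b \<oplus> a = gyro_id)"

text \<open>The choice is immaterial: see \<open>gyr_unique\<close> below.\<close>

definition gyr :: "'a \<Rightarrow> 'a \<Rightarrow> 'a \<Rightarrow> 'a" where
  "gyr = (SOME g. gyr_family G (\<oplus>) g)"

lemma gyr_family_gyr: "gyr_family G (\<oplus>) gyr"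
  unfolding gyr_def using ex_gyr by (rule someI_ex)

lemma gyr_bij: "a \<in> G \<Longrightarrow> b \<in> G \<Longrightarrow> bij_betw (gyr a b) G G"
  using gyr_family_gyr unfolding gyr_family_def automorphism_on_def by blast

lemma gyr_assoc:
  "a \<in> G \<Longrightarrow> b \<in> G \<Longrightarrow> c \<in> G \<Longrightarrow> a \<oplus> (b \<oplus> c) = (a \<oplus> b) \<oplus> gyr a b c"
  using gyr_family_gyr unfolding gyr_family_def by blast

lemma gyr_loop:
  "a \<in> G \<Longrightarrow> b \<in> G \<Longrightarrow> c \<in> G \<Longrightarrow> gyr (a \<oplus> b) b c = gyr a b c"
  using gyr_family_gyr unfolding gyr_family_def by blast

lemma left_cancel:
  assumes "a \<in> G" "b \<in> G" "c \<in> G" "a \<oplus> b = a \<oplus> c"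
  shows "b = c"
proof -
  obtain e where e: "e \<in> G" "\<forall>a\<in>G. e \<oplus> a = a" "\<forall>a\<in>G. \<exists>b\<in>G. b \<oplus> a = e"
    using left_id_inv by blast
  then obtain x where x: "x \<in> G" "x \<oplus> a = e" using assms by blast
  have bij: "bij_betw (gyr x a) G G" using gyr_bij x assms by blast
  have *: "x \<oplus> (a \<oplus> d) = gyr x a d" if "d \<in> G" for d
    using gyr_assoc[OF x(1) assms(1) that] x e bij_betwE[OF bij] that by simp
  have "gyr x a b = gyr x a c" using *[of b] *[of c] assms by simp
  then show ?thesis using bij assms by (metis bij_betw_imp_inj_on inj_onD)
qed

lemma gyr_unique:
  assumes g: "gyr_family G (\<oplus>) g" and "a \<in> G" "b \<in> G" "c \<in> G"
  shows "g a b c = gyr a b c"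
proof (rule left_cancel[of "a \<oplus> b"])
  have "bij_betw (g a b) G G" using g assms unfolding gyr_family_def automorphism_on_def by blast
  then show "g a b c \<in> G" using assms bij_betwE by blast
  show "gyr a b c \<in> G" using gyr_bij assms bij_betwE by blast
  have "a \<oplus> (b \<oplus> c) = (a \<oplus> b) \<oplus> g a b c" using g assms unfolding gyr_family_def by blast
  then show "(a \<oplus> b) \<oplus> g a b c = (a \<oplus> b) \<oplus> gyr a b c" using gyr_assoc assms by simp
qed (use assms add_closed in auto)

lemma gyr_left_inverse:
  assumes e: "e \<in> G" "\<forall>a\<in>G. e \<oplus> a = a" and a: "a \<in> G" and x: "x \<in> G" "x \<oplus> a = e"
    and c: "c \<in> G"
  shows "x \<oplus> (a \<oplus> c) = c"
proof -
  have "gyr e a c = c"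
  proof (rule left_cancel[of a, symmetric])
    show "gyr e a c \<in> G" using gyr_bij[OF e(1) a] c bij_betwE by blast
    show "a \<oplus> c = a \<oplus> gyr e a c"
      using gyr_assoc[OF e(1) a c] e a c add_closed by simp
  qed (use a c in auto)
  then have "gyr x a c = c"
    using gyr_loop[OF x(1) a c] x by simp
  then show ?thesis using gyr_assoc[OF x(1) a c] x e c by simp
qed

lemma gyro_id_unique: "\<exists>!e. e \<in> G \<and> (\<forall>a\<in>G. e \<oplus> a = a)"
  and gyro_id_right: "a \<in> G \<Longrightarrow> a \<oplus> gyro_id = a"
  and left_inverse_ex: "a \<in> G \<Longrightarrow> \<exists>b\<in>G. b \<oplus> a = gyro_id"
proof -
  obtain e where e: "e \<in> G" "\<forall>a\<in>G. e \<oplus> a = a" "\<forall>a\<in>G. \<exists>b\<in>G. b \<oplus> a = e"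
    using left_id_inv by blast
  have right: "a \<oplus> e = a" if a: "a \<in> G" for a
  proof -
    obtain x where x: "x \<in> G" "x \<oplus> a = e" using e(3) a by blast
    show ?thesis
      by (rule left_cancel[of x])
        (use gyr_left_inverse[OF e(1,2) a x e(1)] x e(1) a add_closed in auto)
  qed
  have uniq: "e' = e" if "e' \<in> G" "\<forall>a\<in>G. e' \<oplus> a = a" for e'
    using right[OF that(1)] that(2) e(1) by simp
  show ex1: "\<exists>!e. e \<in> G \<and> (\<forall>a\<in>G. e \<oplus> a = a)"
    using e(1,2) uniq by blast
  have "gyro_id = e"
    unfolding gyro_id_def using e(1,2) uniq by (intro the_equality) blast+
  then show "a \<in> G \<Longrightarrow> a \<oplus> gyro_id = a" "a \<in> G \<Longrightarrow> \<exists>b\<in>G. b \<oplus> a = gyro_id"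
    using right e(3) by simp_all
qed

lemma gyro_id_mem: "gyro_id \<in> G"
  and gyro_id_left: "a \<in> G \<Longrightarrow> gyro_id \<oplus> a = a"
  using theI'[OF gyro_id_unique] unfolding gyro_id_def by blast+

lemma left_inverse_is_right:
  assumes "a \<in> G" "x \<in> G" "x \<oplus> a = gyro_id"
  shows "a \<oplus> x = gyro_id"
  using gyr_left_inverse[OF gyro_id_mem _ assms assms(2)]
  by (intro left_cancel[of x "a \<oplus> x" gyro_id])
     (simp_all add: assms add_closed gyro_id_mem gyro_id_left gyro_id_right)

lemma gyro_inv_unique:
  assumes "a \<in> G"
  shows "\<exists>!b. b \<in> G \<and> b \<oplus> a = gyro_id"
  using left_inverse_ex[OF assms] left_inverse_is_right[OF assms] left_cancel[OF assms] by metis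

lemma gyro_inv_mem: "a \<in> G \<Longrightarrow> \<ominus> a \<in> G"
  and gyro_inv_left: "a \<in> G \<Longrightarrow> \<ominus> a \<oplus> a = gyro_id"
  using theI'[OF gyro_inv_unique] unfolding gyro_inv_def by blast+

lemma gyro_inv_right: "a \<in> G \<Longrightarrow> a \<oplus> \<ominus> a = gyro_id"
  using left_inverse_is_right gyro_inv_mem gyro_inv_left by blast

end

locale gyronorm = gyrogroup G add
  for G :: "'a set" and add :: "'a \<Rightarrow> 'a \<Rightarrow> 'a"  (infixl "\<oplus>" 65) +
  fixes N :: "'a \<Rightarrow> real"
  assumes nonneg: "\<And>x. x \<in> G \<Longrightarrow> N x \<ge> 0"
    and zero_iff: "\<And>x. x \<in> G \<Longrightarrow> N x = 0 \<longleftrightarrow> x = gyro_id"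
    and inv_invariant: "\<And>x. x \<in> G \<Longrightarrow> N (\<ominus> x) = N x"
    and triangle: "\<And>x y. x \<in> G \<Longrightarrow> y \<in> G \<Longrightarrow> N (x \<oplus> y) \<le> N x + N y"
    and gyr_invariant: "\<And>a b x. a \<in> G \<Longrightarrow> b \<in> G \<Longrightarrow> x \<in> G \<Longrightarrow> N (gyr a b x) = N x"

text \<open>The following functions are meant on the open unit ball only.\<close>

definition mobius_add :: "real ^ 'n \<Rightarrow> real ^ 'n \<Rightarrow> real ^ 'n"  (infixl "\<oplus>\<^sub>M" 65) where
  "u \<oplus>\<^sub>M v =
     (1 / (1 + 2 * (u \<bullet> v) + (norm u)\<^sup>2 * (norm v)\<^sup>2)) *\<^sub>R
       ((1 + 2 * (u \<bullet> v) + (norm v)\<^sup>2) *\<^sub>R u + (1 - (norm u)\<^sup>2) *\<^sub>R v)"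

definition Phi :: "real ^ 'n \<Rightarrow> real ^ 'n" where
  "Phi v = (2 / (1 + (norm v)\<^sup>2)) *\<^sub>R v"

lemma Phi_mem_ball:
  assumes "v \<in> ball 0 1"
  shows "Phi v \<in> ball 0 1"
proof -
  have "0 < (1 - norm v)\<^sup>2" using assms by simp
  then have "2 * norm v < 1 + (norm v)\<^sup>2" by (simp add: power2_diff)
  moreover have "0 < 1 + (norm v)\<^sup>2" by (simp add: add_pos_nonneg)
  ultimately show ?thesis by (simp add: Phi_def)
qed

definition norm_E :: "real ^ 'n \<Rightarrow> real" where
  "norm_E v = artanh (norm v)"

definition norm_M :: "real ^ 'n \<Rightarrow> real" where
  "norm_M v = 1 / 2 * norm_E (Phi v)"

end

theory Submission
  imports Defs
begin

text \<open>By the double-argument formula for \<open>artanh\<close>, the norm is \<open>artanh (norm v)\<close>, and its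
  triangle inequality is \<open>norm (u \<oplus>\<^sub>M v) \<le> (norm u + norm v) / (1 + norm u * norm v)\<close>
  combined with the addition formula for \<open>artanh\<close>. The gyration generated by \<open>u\<close> and \<open>v\<close> is
  written down explicitly as a rotation in the plane of \<open>u\<close> and \<open>v\<close>. Being a linear isometry, it
  preserves the norm and every operation built from inner products, in particular \<open>\<oplus>\<^sub>M\<close>;
  gyroassociativity and the loop property become polynomial identities in the inner products.\<close>

section \<open>Denominator, numerator and norm of a Moebius sum\<close>

definition mobius_den :: "real ^ 'n \<Rightarrow> real ^ 'n \<Rightarrow> real" where
  "mobius_den u v = 1 + 2 * (u \<bullet> v) + (u \<bullet> u) * (v \<bullet> v)"

text \<open>Written, like \<open>mobius_den\<close>, with inner products instead of norms, so that
  the identities below are polynomial and \<open>algebra\<close> can verify them.\<close>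

definition mobius_num :: "real ^ 'n \<Rightarrow> real ^ 'n \<Rightarrow> real ^ 'n" where
  "mobius_num u v = (1 + 2 * (u \<bullet> v) + v \<bullet> v) *\<^sub>R u + (1 - u \<bullet> u) *\<^sub>R v"

lemma mobius_add_eq: "u \<oplus>\<^sub>M v = (1 / mobius_den u v) *\<^sub>R mobius_num u v"
  by (simp add: mobius_add_def mobius_den_def mobius_num_def dot_square_norm)

lemma mobius_den_pos:
  assumes "u \<in> ball 0 1" "v \<in> ball 0 1"
  shows "mobius_den u v > 0"
proof -
  have "norm u * norm v < 1"
    using assms mult_strict_mono'[of "norm u" 1 "norm v" 1] by simp
  then have "(1 - norm u * norm v)\<^sup>2 > 0" by simp
  moreover have "- (norm u * norm v) \<le> u \<bullet> v"
    using Cauchy_Schwarz_ineq2[of u v] by linarith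
  ultimately show ?thesis
    by (simp add: mobius_den_def dot_square_norm power2_diff power_mult_distrib)
qed

lemma mobius_add_num:
  assumes "u \<in> ball 0 1" "v \<in> ball 0 1"
  shows "mobius_den u v *\<^sub>R (u \<oplus>\<^sub>M v) = mobius_num u v"
  using mobius_den_pos[OF assms] by (simp add: mobius_add_eq)

text \<open>Only one factor \<open>mobius_den u v\<close> splits off, so the squared norm of the
  Moebius sum is |u + v|^2 divided by that single factor.\<close>

lemma mobius_num_inner_self:
  "mobius_num u v \<bullet> mobius_num u v = mobius_den u v * (u \<bullet> u + 2 * (u \<bullet> v) + v \<bullet> v)"
  unfolding mobius_num_def mobius_den_def
  by (simp add: inner_simps inner_commute) algebra

lemma mobius_add_inner_self:
  assumes "u \<in> ball 0 1" "v \<in> ball 0 1"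
  shows "mobius_den u v * ((u \<oplus>\<^sub>M v) \<bullet> (u \<oplus>\<^sub>M v)) = u \<bullet> u + 2 * (u \<bullet> v) + v \<bullet> v"
  using mobius_den_pos[OF assms] by (simp add: mobius_add_eq mobius_num_inner_self)

text \<open>The denominator minus |u + v|^2 factors into the right-hand side. Both the closure of
  the ball and the norm bound rest on this.\<close>

lemma one_minus_mobius_add_norm:
  assumes "u \<in> ball 0 1" "v \<in> ball 0 1"
  shows "mobius_den u v * (1 - (norm (u \<oplus>\<^sub>M v))\<^sup>2) = (1 - (norm u)\<^sup>2) * (1 - (norm v)\<^sup>2)"
  using mobius_add_inner_self[OF assms]
  by (simp add: dot_square_norm[symmetric] mobius_den_def algebra_simps)

lemma mobius_add_mem_ball:
  assumes "u \<in> ball 0 1" "v \<in> ball 0 1"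
  shows "u \<oplus>\<^sub>M v \<in> ball 0 1"
proof -
  have "(1 - (norm u)\<^sup>2) * (1 - (norm v)\<^sup>2) > 0"
    using assms by (intro mult_pos_pos) (simp_all add: power_less_one_iff abs_square_less_1)
  then have "1 - (norm (u \<oplus>\<^sub>M v))\<^sup>2 > 0"
    using one_minus_mobius_add_norm[OF assms] mobius_den_pos[OF assms]
    by (metis zero_less_mult_pos)
  then show ?thesis by (simp add: abs_square_less_1)
qed

text \<open>The extreme case is that of equal directions: the denominator then attains its
  Cauchy-Schwarz bound (1 + |u| |v|)^2. For given |u| and |v|, a larger denominator forces a larger
  norm of the sum.\<close>

lemma norm_mobius_add_le:
  assumes "u \<in> ball 0 1" "v \<in> ball 0 1"
  shows "norm (u \<oplus>\<^sub>M v) \<le> (norm u + norm v) / (1 + norm u * norm v)"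
proof -
  define r s n D where "r = norm u" "s = norm v" "n = norm (u \<oplus>\<^sub>M v)" "D = mobius_den u v"
  note defs = this
  have rs: "0 \<le> r" "r < 1" "0 \<le> s" "s < 1" "0 \<le> n" and D: "D > 0"
    using assms mobius_den_pos[OF assms] by (simp_all add: defs)
  have pos: "1 + r * s > 0" using rs by (simp add: add_pos_nonneg)
  have Dle: "D \<le> (1 + r * s)\<^sup>2"
    using norm_cauchy_schwarz[of u v]
    by (simp add: defs mobius_den_def dot_square_norm power2_sum power_mult_distrib)
  have nn: "1 - n\<^sup>2 \<ge> 0"
    using mobius_add_mem_ball[OF assms] by (simp add: defs abs_square_le_1)
  have "(1 - r\<^sup>2) * (1 - s\<^sup>2) = D * (1 - n\<^sup>2)"
    using one_minus_mobius_add_norm[OF assms] by (simp add: defs)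
  also have "\<dots> \<le> (1 + r * s)\<^sup>2 * (1 - n\<^sup>2)"
    by (intro mult_right_mono Dle nn)
  \<comment> \<open>Uses (1 - r^2) (1 - s^2) = (1 + r s)^2 - (r + s)^2.\<close>
  finally have "(n * (1 + r * s))\<^sup>2 \<le> (r + s)\<^sup>2"
    by (simp add: power2_eq_square algebra_simps)
  then have "n * (1 + r * s) \<le> r + s"
    by (rule power2_le_imp_le) (use rs in simp)
  then show ?thesis using pos by (simp add: defs[symmetric] pos_le_divide_eq)
qed

section \<open>Gyrations as plane rotations, and gyroassociativity\<close>

definition bivector :: "real ^ 'n \<Rightarrow> real ^ 'n \<Rightarrow> real ^ 'n \<Rightarrow> real ^ 'n" where
  "bivector u v w = (u \<bullet> w) *\<^sub>R v - (v \<bullet> w) *\<^sub>R u"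

text \<open>The Euler-Rodrigues form of a rotation, with \<open>mobius_den u v\<close> as the
  squared length of the rotor. In the complex plane it is multiplication by (1 + u conj(v)) / (1 +
  conj(u) v).\<close>

definition mobius_gyr :: "real ^ 'n \<Rightarrow> real ^ 'n \<Rightarrow> real ^ 'n \<Rightarrow> real ^ 'n" where
  "mobius_gyr u v w = w + (2 / mobius_den u v) *\<^sub>R
     (bivector u v (bivector u v w) - (1 + u \<bullet> v) *\<^sub>R bivector u v w)"

lemma linear_mobius_gyr: "linear (mobius_gyr u v)"
  by (rule linearI)
    (simp_all add: mobius_gyr_def bivector_def inner_simps algebra_simps)

lemma mobius_gyr_inner_self:
  assumes "mobius_den u v \<noteq> 0"
  shows "mobius_gyr u v w \<bullet> mobius_gyr u v w = w \<bullet> w"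
proof -
  define k where "k = 2 / mobius_den u v"
  define J where "J = bivector u v w"
  have k: "k * (1 + 2 * (u \<bullet> v) + (u \<bullet> u) * (v \<bullet> v)) = 2"
    using assms by (simp add: k_def flip: mobius_den_def)
  \<comment> \<open>\<open>bivector u v\<close> is skew-adjoint.\<close>
  have 1: "w \<bullet> J = 0" "w \<bullet> bivector u v J = - (J \<bullet> J)" "J \<bullet> bivector u v J = 0"
    by (simp_all add: J_def bivector_def inner_simps inner_commute algebra_simps)
  \<comment> \<open>On the plane of \<open>u\<close> and \<open>v\<close>, the square of
    \<open>bivector u v\<close> is minus the squared area of their parallelogram.\<close>
  have 2: "bivector u v J \<bullet> bivector u v J = ((u \<bullet> u) * (v \<bullet> v) - (u \<bullet> v)\<^sup>2) * (J \<bullet> J)"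
    by (simp add: J_def bivector_def inner_simps inner_commute) algebra
  have "mobius_gyr u v w = w + k *\<^sub>R (bivector u v J - (1 + u \<bullet> v) *\<^sub>R J)"
    by (simp add: mobius_gyr_def k_def J_def)
  then have "mobius_gyr u v w \<bullet> mobius_gyr u v w = w \<bullet> w - 2 * k * (J \<bullet> J)
     + k\<^sup>2 * (bivector u v J \<bullet> bivector u v J + (1 + u \<bullet> v)\<^sup>2 * (J \<bullet> J))"
    by (simp add: inner_simps 1 1(2)[unfolded inner_commute[of w]] 1(1)[unfolded inner_commute[of w]]
        1(3)[unfolded inner_commute[of J]])
       (simp add: algebra_simps power2_eq_square)
  \<comment> \<open>The squared area and \<open>(1 + u \<bullet> v)\<^sup>2\<close> add up to the
    denominator; \<open>k\<close> is 2 divided by it, so the terms in \<open>J\<close>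
    cancel.\<close>
  also have "\<dots> = w \<bullet> w + (J \<bullet> J) * k * (k * (1 + 2 * (u \<bullet> v) + (u \<bullet> u) * (v \<bullet> v)) - 2)"
    unfolding 2 by algebra
  also have "\<dots> = w \<bullet> w" by (simp add: k)
  finally show ?thesis .
qed

lemma orthogonal_mobius_gyr:
  assumes "u \<in> ball 0 1" "v \<in> ball 0 1"
  shows "orthogonal_transformation (mobius_gyr u v)"
  unfolding orthogonal_transformation
  using linear_mobius_gyr mobius_gyr_inner_self mobius_den_pos[OF assms]
  by (metis less_irrefl norm_eq_sqrt_inner)

lemma orthogonal_mobius_add:
  assumes "orthogonal_transformation f"
  shows "f (u \<oplus>\<^sub>M v) = f u \<oplus>\<^sub>M f v"
  using assms orthogonal_transformation_linear[OF assms]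
  by (simp add: mobius_add_def linear_add linear_scale orthogonal_transformation_norm
      orthogonal_transformation_def)

lemma automorphism_mobius_gyr:
  assumes "u \<in> ball 0 1" "v \<in> ball 0 1"
  shows "automorphism_on (ball 0 1) (\<oplus>\<^sub>M) (mobius_gyr u v)"
proof -
  note o = orthogonal_mobius_gyr[OF assms]
  have "bij_betw (mobius_gyr u v) (ball 0 1) (ball 0 1)"
    unfolding bij_betw_def
    using orthogonal_transformation_inj[OF o] image_orthogonal_transformation_ball[OF o, of 0 1]
      linear_0[OF linear_mobius_gyr]
    by (metis inj_on_subset subset_UNIV)
  then show ?thesis using orthogonal_mobius_add[OF o] by (simp add: automorphism_on_def)
qed

text \<open>\<open>mobius_gyr u v\<close> is the rotation given by the rotor \<open>1 + u \<bullet> v + u \<and> v\<close>, hence depends on this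
  rotor only up to scaling; replacing \<open>u\<close> by \<open>u \<oplus>\<^sub>M v\<close> multiplies the rotor by
  the coefficient \<open>k\<close> of \<open>u\<close> in \<open>u \<oplus>\<^sub>M v\<close>.\<close>

lemma mobius_gyr_loop:
  assumes "u \<in> ball 0 1" "v \<in> ball 0 1"
  shows "mobius_gyr (u \<oplus>\<^sub>M v) v w = mobius_gyr u v w"
proof -
  define k where "k = (1 + 2 * (u \<bullet> v) + v \<bullet> v) / mobius_den u v"
  define m where "m = (1 - u \<bullet> u) / mobius_den u v"
  define p where "p = u \<oplus>\<^sub>M v"
  note D = mobius_den_pos[OF assms]
  have p: "p = k *\<^sub>R u + m *\<^sub>R v"
    by (simp add: p_def mobius_add_eq mobius_num_def k_def m_def scaleR_right_distrib)
  \<comment> \<open>The numerator of \<open>k\<close> is (1 - |u|^2) + |u + v|^2.\<close>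
  have "u \<bullet> u < 1" using assms by (simp add: dot_square_norm abs_square_less_1)
  moreover have "(u + v) \<bullet> (u + v) \<ge> 0" by simp
  ultimately have "1 + 2 * (u \<bullet> v) + v \<bullet> v > 0"
    by (simp add: inner_simps inner_commute)
  then have k: "k > 0" using D by (simp add: k_def)
  have J: "bivector p v x = k *\<^sub>R bivector u v x" for x
    by (simp add: p bivector_def inner_simps algebra_simps)
  have kD: "k * mobius_den u v = 1 + 2 * (u \<bullet> v) + v \<bullet> v"
    and mD: "m * mobius_den u v = 1 - u \<bullet> u"
    using D by (simp_all add: k_def m_def)
  have "mobius_den u v * (1 + p \<bullet> v) = mobius_den u v * (k * (1 + u \<bullet> v))"
  proof -
    have "mobius_den u v * (1 + p \<bullet> v) = mobius_den u v + (k * mobius_den u v) * (u \<bullet> v)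
        + (m * mobius_den u v) * (v \<bullet> v)"
      by (simp add: p inner_simps algebra_simps)
    also have "\<dots> = (k * mobius_den u v) * (1 + u \<bullet> v)"
      unfolding kD mD by (simp add: mobius_den_def algebra_simps)
    finally show ?thesis by (simp add: mult_ac)
  qed
  then have X: "1 + p \<bullet> v = k * (1 + u \<bullet> v)" using D by simp
  \<comment> \<open>The squared length of the rotor, split into its scalar and bivector parts;
    passing from \<open>u\<close> to \<open>p\<close> scales each part by \<open>k\<close>.\<close>
  have den: "mobius_den a v = (1 + a \<bullet> v)\<^sup>2 + ((a \<bullet> a) * (v \<bullet> v) - (a \<bullet> v)\<^sup>2)" for a
    by (simp add: mobius_den_def power2_eq_square algebra_simps)
  have "(p \<bullet> p) * (v \<bullet> v) - (p \<bullet> v)\<^sup>2 = k\<^sup>2 * ((u \<bullet> u) * (v \<bullet> v) - (u \<bullet> v)\<^sup>2)"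
    by (simp add: p inner_simps inner_commute) algebra
  then have D': "mobius_den p v = k\<^sup>2 * mobius_den u v"
    unfolding den X by algebra
  have lin: "bivector u v (k *\<^sub>R x) = k *\<^sub>R bivector u v x" for x
    by (simp add: bivector_def algebra_simps)
  have "mobius_gyr p v w = mobius_gyr u v w"
    using k by (simp add: mobius_gyr_def D' J X lin power2_eq_square algebra_simps)
  then show ?thesis by (simp add: p_def)
qed

text \<open>Gyrocommutativity in weak form: the gyration is an isometry taking
  \<open>mobius_num v u\<close> to \<open>mobius_num u v\<close>. It removes the gyration from the
  inner product needed for gyroassociativity.\<close>

lemma inner_mobius_num_gyr:
  assumes "mobius_den u v \<noteq> 0"
  shows "mobius_num u v \<bullet> mobius_gyr u v w = mobius_num v u \<bullet> w"
proof -
  define h where "h = bivector u v (bivector u v w) - (1 + u \<bullet> v) *\<^sub>R bivector u v w"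
  have "2 * (mobius_num u v \<bullet> h) = mobius_den u v * (mobius_num v u \<bullet> w - mobius_num u v \<bullet> w)"
    unfolding h_def mobius_num_def bivector_def mobius_den_def
    by (simp add: inner_simps inner_commute) algebra
  then show ?thesis
    using assms by (simp add: mobius_gyr_def inner_simps flip: h_def)
qed

text \<open>Once scaled by the inner denominators \<open>E\<close> and \<open>D\<close>, the outer
  denominators of the two sides agree, and so do the outer numerators.\<close>

lemma mobius_add_gyroassoc:
  assumes a: "a \<in> ball 0 1" and b: "b \<in> ball 0 1" and c: "c \<in> ball 0 1"
  shows "a \<oplus>\<^sub>M (b \<oplus>\<^sub>M c) = (a \<oplus>\<^sub>M b) \<oplus>\<^sub>M mobius_gyr a b c"
proof -
  define p q g where "p = a \<oplus>\<^sub>M b" "q = b \<oplus>\<^sub>M c" "g = mobius_gyr a b c"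
  note defs = this
  define D E where "D = mobius_den a b" "E = mobius_den b c"
  note DE = this
  have pb: "p \<in> ball 0 1" and qb: "q \<in> ball 0 1"
    using a b c mobius_add_mem_ball by (auto simp: defs)
  have gb: "g \<in> ball 0 1"
    using automorphism_mobius_gyr[OF a b] c by (auto simp: defs automorphism_on_def bij_betw_def)
  have D: "D > 0" and E: "E > 0" using mobius_den_pos a b c by (auto simp: DE)
  have Dp: "D *\<^sub>R p = mobius_num a b" and Eq: "E *\<^sub>R q = mobius_num b c"
    using mobius_add_num a b c by (auto simp: DE defs)
  \<comment> \<open>Multiplied by \<open>D\<close> or \<open>E\<close>, the inner products of the
    outer sums become polynomials in those of \<open>a\<close>, \<open>b\<close>,
    \<open>c\<close>.\<close>
  have pp: "D * (p \<bullet> p) = a \<bullet> a + 2 * (a \<bullet> b) + b \<bullet> b"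
    and qq: "E * (q \<bullet> q) = b \<bullet> b + 2 * (b \<bullet> c) + c \<bullet> c"
    using mobius_add_inner_self a b c by (auto simp: DE defs)
  have gg: "g \<bullet> g = c \<bullet> c"
    using mobius_gyr_inner_self[of a b c] D by (simp add: DE defs)
  have pg: "D * (p \<bullet> g) = mobius_num b a \<bullet> c"
    using inner_mobius_num_gyr[of a b c] D
    by (simp add: Dp[symmetric] DE defs flip: inner_scaleR_left)
  have aq: "E * (a \<bullet> q) = a \<bullet> mobius_num b c"
    by (simp add: Eq[symmetric])
  have "E * mobius_den a q = E + 2 * (E * (a \<bullet> q)) + (a \<bullet> a) * (E * (q \<bullet> q))"
    by (simp add: mobius_den_def algebra_simps)
  also have "\<dots> = D + 2 * (D * (p \<bullet> g)) + (D * (p \<bullet> p)) * (c \<bullet> c)"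
    unfolding aq qq pg pp
    by (simp add: DE mobius_den_def mobius_num_def inner_simps
        inner_commute algebra_simps)
  also have "\<dots> = D * mobius_den p g"
    by (simp add: mobius_den_def gg algebra_simps)
  finally have den: "E * mobius_den a q = D * mobius_den p g" .
  have "E *\<^sub>R mobius_num a q = (E + 2 * (E * (a \<bullet> q)) + E * (q \<bullet> q)) *\<^sub>R a + (1 - a \<bullet> a) *\<^sub>R (E *\<^sub>R q)"
    by (simp add: mobius_num_def algebra_simps)
  also have "\<dots> = (D + 2 * (D * (p \<bullet> g)) + D * (c \<bullet> c)) *\<^sub>R p + (D - D * (p \<bullet> p)) *\<^sub>R g"
  proof -
    define h where "h = bivector a b (bivector a b c) - (1 + a \<bullet> b) *\<^sub>R bivector a b c"
    have Dg: "D *\<^sub>R g = D *\<^sub>R c + 2 *\<^sub>R h"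
      using D by (simp add: defs mobius_gyr_def DE h_def scaleR_right_distrib)
    \<comment> \<open>The coefficients of \<open>p\<close> and \<open>g\<close>, made polynomial by
      \<open>pg\<close> and \<open>pp\<close>. As \<open>p\<close> and \<open>g\<close> still
      contain 1 / \<open>D\<close>, the equation is multiplied by \<open>D\<close> once more and
      then checked in coordinates.\<close>
    define r s where rs: "r = D + 2 * (mobius_num b a \<bullet> c) + D * (c \<bullet> c)"
      and ss: "s = D - (a \<bullet> a + 2 * (a \<bullet> b) + b \<bullet> b)"
    have "D *\<^sub>R ((E + 2 * (a \<bullet> mobius_num b c) + (b \<bullet> b + 2 * (b \<bullet> c) + c \<bullet> c)) *\<^sub>R a
        + (1 - a \<bullet> a) *\<^sub>R mobius_num b c)
      = r *\<^sub>R mobius_num a b + s *\<^sub>R (D *\<^sub>R c + 2 *\<^sub>R h)"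
      unfolding rs ss vec_eq_iff h_def DE mobius_den_def mobius_num_def bivector_def
      by (intro allI, simp add: inner_simps inner_commute) algebra
    also have "\<dots> = D *\<^sub>R (r *\<^sub>R p + s *\<^sub>R g)"
      by (simp add: scaleR_right_distrib mult.commute flip: Dp Dg)
    finally show ?thesis
      using D unfolding aq qq pg pp Eq rs ss by simp
  qed
  also have "\<dots> = D *\<^sub>R mobius_num p g"
    by (simp add: mobius_num_def gg algebra_simps)
  finally have num: "E *\<^sub>R mobius_num a q = D *\<^sub>R mobius_num p g" .
  have "a \<oplus>\<^sub>M q = (1 / (E * mobius_den a q)) *\<^sub>R (E *\<^sub>R mobius_num a q)"
    using E by (simp add: mobius_add_eq)
  also have "\<dots> = p \<oplus>\<^sub>M g"
    unfolding den num using D by (simp add: mobius_add_eq)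
  finally show ?thesis by (simp add: defs)
qed

section \<open>The Moebius gyrogroup\<close>

lemma gyr_family_mobius:
  "gyr_family (ball (0 :: real ^ 'n) 1) (\<oplus>\<^sub>M) mobius_gyr"
  unfolding gyr_family_def
  using automorphism_mobius_gyr mobius_add_gyroassoc mobius_gyr_loop by blast

lemma mobius_add_zero_left: "0 \<oplus>\<^sub>M v = v"
  by (simp add: mobius_add_def)

lemma mobius_add_minus_left: "- v \<oplus>\<^sub>M v = 0"
  by (simp add: mobius_add_def dot_square_norm scaleR_right_distrib[symmetric])

interpretation mobius: gyrogroup "ball (0 :: real ^ 'n) 1" "(\<oplus>\<^sub>M)"
proof
  show "\<exists>e\<in>ball (0 :: real ^ 'n) 1. (\<forall>a\<in>ball 0 1. e \<oplus>\<^sub>M a = a) \<and>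
      (\<forall>a\<in>ball 0 1. \<exists>b\<in>ball 0 1. b \<oplus>\<^sub>M a = e)"
  proof (rule bexI[of _ 0], intro conjI ballI)
    fix a :: "real ^ 'n" assume "a \<in> ball 0 1"
    then show "\<exists>b\<in>ball 0 1. b \<oplus>\<^sub>M a = 0"
      by (intro bexI[of _ "- a"]) (simp_all add: mobius_add_minus_left)
  qed (simp_all add: mobius_add_zero_left)
qed (use mobius_add_mem_ball gyr_family_mobius in blast)+

lemma mobius_gyro_id: "mobius.gyro_id = (0 :: real ^ 'n)"
proof -
  have "(0 :: real ^ 'n) \<oplus>\<^sub>M mobius.gyro_id = 0"
    by (rule mobius.gyro_id_right) simp
  then show ?thesis by (simp add: mobius_add_zero_left)
qed

lemma mobius_gyro_inv: "v \<in> ball 0 1 \<Longrightarrow> mobius.gyro_inv v = - v"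
  unfolding mobius.gyro_inv_def mobius_gyro_id
  using mobius.gyro_inv_unique[of v] mobius_add_minus_left[of v]
  by (intro the1_equality) (simp_all add: mobius_gyro_id)

section \<open>Identities for artanh, and the gyronorm\<close>

lemma artanh_double:
  fixes r :: real
  assumes "\<bar>r\<bar> < 1"
  shows "artanh (2 * r / (1 + r\<^sup>2)) = 2 * artanh r"
proof -
  have pos: "1 + r\<^sup>2 > 0" "1 + r > 0" "1 - r > 0" using assms by (auto intro: add_pos_nonneg)
  \<comment> \<open>\<open>artanh x\<close> is half the logarithm of (1 + x) / (1 - x), a quotient
    that the substitution squares.\<close>
  have "1 + 2 * r / (1 + r\<^sup>2) = (1 + r)\<^sup>2 / (1 + r\<^sup>2)"
    "1 - 2 * r / (1 + r\<^sup>2) = (1 - r)\<^sup>2 / (1 + r\<^sup>2)"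
    using pos by (simp_all add: field_simps power2_eq_square)
  then have "(1 + 2 * r / (1 + r\<^sup>2)) / (1 - 2 * r / (1 + r\<^sup>2)) = ((1 + r) / (1 - r))\<^sup>2"
    using pos by (simp add: power_divide)
  then show ?thesis using pos by (simp add: artanh_def ln_realpow)
qed

text \<open>The quotients (1 + x) / (1 - x) multiply under this sum of arguments.\<close>

lemma artanh_add:
  fixes r s :: real
  assumes "\<bar>r\<bar> < 1" "\<bar>s\<bar> < 1"
  shows "artanh ((r + s) / (1 + r * s)) = artanh r + artanh s"
proof -
  have "\<bar>r * s\<bar> < 1" using assms by (metis abs_mult abs_ge_zero mult_strict_mono' mult_1)
  then have pos: "1 + r * s > 0" "1 + r > 0" "1 - r > 0" "1 + s > 0" "1 - s > 0"
    using assms by auto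
  have "1 + (r + s) / (1 + r * s) = (1 + r) * (1 + s) / (1 + r * s)"
    "1 - (r + s) / (1 + r * s) = (1 - r) * (1 - s) / (1 + r * s)"
    using pos by (simp_all add: field_simps)
  then have "(1 + (r + s) / (1 + r * s)) / (1 - (r + s) / (1 + r * s))
      = (1 + r) / (1 - r) * ((1 + s) / (1 - s))"
    using pos by simp
  moreover have "(1 + r) / (1 - r) > 0" "(1 + s) / (1 - s) > 0"
    using pos by simp_all
  ultimately show ?thesis
    unfolding artanh_def by (simp only: ln_mult_pos add_divide_distrib)
qed

lemma artanh_mono:
  fixes r s :: real
  assumes "-1 < r" "r \<le> s" "s < 1"
  shows "artanh r \<le> artanh s"
proof -
  have "(1 + r) / (1 - r) \<le> (1 + s) / (1 - s)"
    using assms by (intro frac_le) auto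
  then show ?thesis using assms by (simp add: artanh_def)
qed

lemma artanh_eq_0_iff:
  fixes r :: real
  assumes "\<bar>r\<bar> < 1"
  shows "artanh r = 0 \<longleftrightarrow> r = 0"
  using assms by (auto simp: artanh_def divide_eq_1_iff)

text \<open>\<open>Phi v\<close> is \<open>v \<oplus>\<^sub>M v\<close>; the factor 1/2 undoes this
  doubling.\<close>

lemma norm_M_eq:
  assumes "v \<in> ball 0 1"
  shows "norm_M v = artanh (norm v)"
  using artanh_double[of "norm v"] assms
  by (simp add: norm_M_def norm_E_def Phi_def abs_of_nonneg)

lemma norm_M_cong: "norm u = norm v \<Longrightarrow> norm_M u = norm_M v"
  by (simp add: norm_M_def norm_E_def Phi_def)

theorem theorem3p4:
  shows "gyronorm (ball (0 :: real ^ 'n) 1) (\<oplus>\<^sub>M) norm_M"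
proof
  fix x y :: "real ^ 'n"
  assume x: "x \<in> ball 0 1"
  show "norm_M x \<ge> 0"
    using artanh_mono[of 0 "norm x"] x by (simp add: norm_M_eq)
  show "norm_M x = 0 \<longleftrightarrow> x = mobius.gyro_id"
    using x by (simp add: norm_M_eq artanh_eq_0_iff mobius_gyro_id)
  show "norm_M (mobius.gyro_inv x) = norm_M x"
    by (rule norm_M_cong) (simp add: mobius_gyro_inv[OF x])
  assume y: "y \<in> ball 0 1"
  have "norm_M (x \<oplus>\<^sub>M y) = artanh (norm (x \<oplus>\<^sub>M y))"
    by (rule norm_M_eq[OF mobius_add_mem_ball[OF x y]])
  also have "\<dots> \<le> artanh ((norm x + norm y) / (1 + norm x * norm y))"
  proof (rule artanh_mono[OF _ norm_mobius_add_le[OF x y]])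
    show "- 1 < norm (x \<oplus>\<^sub>M y)" by (rule less_le_trans[OF _ norm_ge_zero]) simp
    \<comment> \<open>Expanded, this says |x| + |y| < 1 + |x| |y|.\<close>
    have "(1 - norm x) * (1 - norm y) > 0" using x y by simp
    then show "(norm x + norm y) / (1 + norm x * norm y) < 1"
      by (simp add: pos_divide_less_eq add_pos_nonneg algebra_simps)
  qed
  also have "\<dots> = norm_M x + norm_M y"
    using x y by (simp add: artanh_add norm_M_eq)
  finally show "norm_M (x \<oplus>\<^sub>M y) \<le> norm_M x + norm_M y" .
next
  fix a b x :: "real ^ 'n"
  assume "a \<in> ball 0 1" "b \<in> ball 0 1" "x \<in> ball 0 1"
  \<comment> \<open>The gyration of the locale is an arbitrary choice; uniqueness identifies it on
    the ball with the explicit rotation.\<close>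
  then have "mobius.gyr a b x = mobius_gyr a b x"
    and "norm (mobius_gyr a b x) = norm x"
    using mobius.gyr_unique[OF gyr_family_mobius, of a b x]
      orthogonal_transformation_norm[OF orthogonal_mobius_gyr, of a b x] by simp_all
  then show "norm_M (mobius.gyr a b x) = norm_M x"
    by (intro norm_M_cong) simp
qed

end
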